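(* Let $\sigma>0$ and let $\mu$ be a real function of bounded variation on the segment $[0,\sigma]$. Put $$F(z):=\int_0^\sigma e^{izt}\,d\mu(t),\qquad C(z):=-\int_0^\sigma\cos(zt)\,d\mu(\sigma-t).$$ Suppose that $C(x)\ge0$ for all $x\in\mathbb{R}$ and $F(z)\not\equiv0$. Then $F\in\overline{HB}$ and $F$ is not trivial. All real zeros of $F$, if there are any, are simple.
   Context: Integrals are Stieltjes integrals over $[0,\sigma]$ (jumps of $\mu$ at the end points are counted). For an entire function $\omega=P+iQ$ with $P,Q$ entire and real-valued on $\mathbb{R}$, $\overline{\omega}(z):=P(z)-iQ(z)=\overline{\omega(\overline z)}$. $\overline{HB}$ is the class of entire functions $\omega$ that have no zeros in the open lower half-plane $\operatorname{Im}z<0$ and satisfy $\bigl|\omega(z)/\overline{\omega}(z)\bigr|\le1$ for $\operatorname{Im}z>0$. A function in $\overline{HB}$ is called trivial if it is real up to a constant factor, i.e. equals a complex constant times an entire function that is real on the real axis. *)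

theory Defs
  imports "HOL-Complex_Analysis.Complex_Analysis"
begin

definition bounded_variation_on :: "(real \<Rightarrow> real) \<Rightarrow> real \<Rightarrow> real \<Rightarrow> bool" where
  "bounded_variation_on \<mu> a b \<longleftrightarrow>
     (\<exists>B. \<forall>d. d division_of {a..b} \<longrightarrow> (\<Sum>K\<in>d. \<bar>\<mu> (Sup K) - \<mu> (Inf K)\<bar>) \<le> B)"

(* Riemann-Stieltjes integral as a limit over tagged partitions of [a,b] whose mesh tends to 0.
   Degenerate cells contribute 0. The values \<mu> a and \<mu> b enter the sums, so jumps of \<mu> at the
   end points are counted. *)
definition has_stieltjes_integral ::
    "(real \<Rightarrow> 'a::real_normed_vector) \<Rightarrow> (real \<Rightarrow> real) \<Rightarrow> real \<Rightarrow> real \<Rightarrow> 'a \<Rightarrow> bool" where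
  "has_stieltjes_integral f \<mu> a b I \<longleftrightarrow>
     (\<forall>e>0. \<exists>\<delta>>0. \<forall>p. p tagged_division_of {a..b} \<and> (\<forall>(t, K)\<in>p. Sup K - Inf K < \<delta>) \<longrightarrow>
        norm ((\<Sum>(t, K)\<in>p. (\<mu> (Sup K) - \<mu> (Inf K)) *\<^sub>R f t) - I) < e)"

definition stieltjes_integral ::
    "real \<Rightarrow> real \<Rightarrow> (real \<Rightarrow> 'a::real_normed_vector) \<Rightarrow> (real \<Rightarrow> real) \<Rightarrow> 'a" where
  "stieltjes_integral a b f \<mu> = (THE I. has_stieltjes_integral f \<mu> a b I)"

lemma has_stieltjes_integral_unique:
  assumes "has_stieltjes_integral f \<mu> a b I" "has_stieltjes_integral f \<mu> a b J"
  shows "I = J"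
proof (rule ccontr)
  assume "I \<noteq> J"
  define e where "e = norm (I - J) / 2"
  have "e > 0" using \<open>I \<noteq> J\<close> by (simp add: e_def)
  let ?S = "\<lambda>p. \<Sum>(t, K)\<in>p. (\<mu> (Sup K) - \<mu> (Inf K)) *\<^sub>R f t"
  obtain d1 where d1: "d1 > 0" "\<forall>p. p tagged_division_of {a..b} \<and>
      (\<forall>(t, K)\<in>p. Sup K - Inf K < d1) \<longrightarrow> norm (?S p - I) < e"
    using assms(1)[unfolded has_stieltjes_integral_def, THEN spec, THEN mp, OF \<open>e > 0\<close>]
    by (elim exE conjE)
  obtain d2 where d2: "d2 > 0" "\<forall>p. p tagged_division_of {a..b} \<and>
      (\<forall>(t, K)\<in>p. Sup K - Inf K < d2) \<longrightarrow> norm (?S p - J) < e"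
    using assms(2)[unfolded has_stieltjes_integral_def, THEN spec, THEN mp, OF \<open>e > 0\<close>]
    by (elim exE conjE)
  define d where "d = min d1 d2"
  have "gauge (\<lambda>x::real. ball x (d / 2))"
    using d1(1) d2(1) by (intro gaugeI) (auto simp: d_def)
  then obtain p where p: "p tagged_division_of {a..b}" "(\<lambda>x. ball x (d / 2)) fine p"
    using fine_division_exists_real by blast
  have mesh: "Sup K - Inf K < d" if "(t, K) \<in> p" for t K
  proof -
    from tagged_division_ofD(2,4)[OF p(1) that]
    obtain u v where K: "K = {u..v}" "u \<le> v" by auto
    have "K \<subseteq> ball t (d / 2)" using p(2) that by (rule fineD)
    then have "u \<in> ball t (d / 2)" "v \<in> ball t (d / 2)" using K by auto
    then have "\<bar>t - u\<bar> < d / 2" "\<bar>t - v\<bar> < d / 2" by (simp_all add: dist_real_def)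
    then have "v - u < d" by linarith
    then show ?thesis using K by simp
  qed
  have m: "\<forall>(t, K)\<in>p. Sup K - Inf K < d1" "\<forall>(t, K)\<in>p. Sup K - Inf K < d2"
    using mesh unfolding d_def by force+
  have "norm (?S p - I) < e"
    by (rule d1(2)[THEN spec, THEN mp, OF conjI, OF p(1) m(1)])
  moreover have "norm (?S p - J) < e"
    by (rule d2(2)[THEN spec, THEN mp, OF conjI, OF p(1) m(2)])
  moreover have "norm (I - J) \<le> norm (?S p - J) + norm (?S p - I)"
    using norm_triangle_ineq4[of "?S p - J" "?S p - I"] by simp
  ultimately have "norm (I - J) < 2 * e"
    by linarith
  then show False by (simp add: e_def)
qed

lemma stieltjes_integral_eqI:
  "has_stieltjes_integral f \<mu> a b I \<Longrightarrow> stieltjes_integral a b f \<mu> = I"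
  unfolding stieltjes_integral_def by (blast intro: has_stieltjes_integral_unique)

definition conj_fun :: "(complex \<Rightarrow> complex) \<Rightarrow> complex \<Rightarrow> complex" where
  "conj_fun \<omega> z = cnj (\<omega> (cnj z))"

definition real_entire :: "(complex \<Rightarrow> complex) \<Rightarrow> bool" where
  "real_entire g \<longleftrightarrow> g holomorphic_on UNIV \<and> (\<forall>x::real. g (of_real x) \<in> \<real>)"

lemma conj_fun_real_entire:
  assumes "real_entire g"
  shows "conj_fun g = g"
proof
  fix z
  have hol: "g holomorphic_on UNIV" and re: "\<And>x::real. g (of_real x) \<in> \<real>"
    using assms by (auto simp: real_entire_def)
  have "(cnj \<circ> g \<circ> cnj) holomorphic_on UNIV"
    by (rule holomorphic_on_compose_cnj_cnj) (auto intro: holomorphic_on_subset[OF hol])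
  also have "cnj \<circ> g \<circ> cnj = conj_fun g"
    by (simp add: fun_eq_iff conj_fun_def)
  finally have hol': "conj_fun g holomorphic_on UNIV" .
  have lim: "(0::complex) islimpt range of_real"
  proof (rule islimptI)
    fix T :: "complex set" assume "0 \<in> T" "open T"
    then obtain e where e: "e > 0" "ball 0 e \<subseteq> T" by (meson openE)
    then have "complex_of_real (e / 2) \<in> T" by (intro subsetD[OF e(2)]) (simp add: norm_divide)
    then show "\<exists>y\<in>range complex_of_real. y \<in> T \<and> y \<noteq> 0"
      using e(1) by (intro bexI[OF _ rangeI[of _ "e / 2"]]) auto
  qed
  have "conj_fun g z - g z = 0"
  proof (rule analytic_continuation[where f = "\<lambda>w. conj_fun g w - g w" and S = UNIV
        and U = "range of_real" and \<xi> = 0])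
    show "(\<lambda>w. conj_fun g w - g w) holomorphic_on UNIV"
      using hol hol' by (intro holomorphic_intros)
    show "conj_fun g w - g w = 0" if "w \<in> range of_real" for w
      using that re by (auto simp: conj_fun_def Reals_cnj_iff)
  qed (use lim in auto)
  then show "conj_fun g z = g z" by simp
qed

lemma conj_fun_eq:
  assumes "real_entire P" "real_entire Q" "\<And>z. \<omega> z = P z + \<i> * Q z"
  shows "conj_fun \<omega> z = P z - \<i> * Q z"
proof -
  have "cnj (P (cnj z)) = P z" "cnj (Q (cnj z)) = Q z"
    using conj_fun_real_entire[OF assms(1)] conj_fun_real_entire[OF assms(2)]
    by (metis conj_fun_def)+
  then show ?thesis by (simp add: conj_fun_def assms(3))
qed

definition HB_bar :: "(complex \<Rightarrow> complex) set" where
  "HB_bar = {\<omega>. \<omega> holomorphic_on UNIV \<and> (\<forall>z. Im z < 0 \<longrightarrow> \<omega> z \<noteq> 0) \<and>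
                 (\<forall>z. Im z > 0 \<longrightarrow> norm (\<omega> z / conj_fun \<omega> z) \<le> 1)}"

definition trivial_HB :: "(complex \<Rightarrow> complex) \<Rightarrow> bool" where
  "trivial_HB \<omega> \<longleftrightarrow> (\<exists>c g. real_entire g \<and> (\<forall>z. \<omega> z = c * g z))"

end

theory Submission
  imports Defs
begin

text \<open>
  Put \<open>G z = exp (- \<i> \<sigma> z) * F z\<close>, which is the Stieltjes integral of \<open>exp (\<i> z (t - \<sigma>))\<close>.
  The exponents \<open>t - \<sigma>\<close> are nonpositive, so \<open>G\<close> is bounded on the closed lower half-plane, and the
  substitution \<open>t \<mapsto> \<sigma> - t\<close> shows that \<open>C x\<close> is the real part of \<open>G x\<close> for real \<open>x\<close>. The hypothesis
  thus says that \<open>G\<close> has nonnegative real part on the boundary of a half-plane where it is bounded.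
  By the Phragmen-Lindelof principle, applied to \<open>exp (- G)\<close>, the real part of \<open>G\<close> is nonnegative
  on the whole half-plane (\<open>Re_nonneg_lower_half_plane\<close>).

  Since \<open>\<mu>\<close> is real, \<open>conj_fun F z = F (- z)\<close>. This function is bounded on the closed lower
  half-plane too, and \<open>\<bar>F (- x)\<bar> = \<bar>G x\<bar>\<close> on the real line. As \<open>Re G \<ge> 0\<close>, the quotient
  \<open>F (- z) / (G z + \<epsilon>)\<close> is bounded for every \<open>\<epsilon> > 0\<close>, and the same principle together with
  \<open>\<epsilon> \<rightarrow> 0\<close> gives \<open>\<bar>F (- z)\<bar> \<le> \<bar>G z\<bar> = exp (\<sigma> Im z) \<bar>F z\<bar>\<close> for \<open>Im z \<le> 0\<close>
  (\<open>norm_le_of_Re_nonneg_lower_half_plane\<close>). The factor \<open>exp (\<sigma> Im z)\<close> is at most 1, which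
  is the inequality that defines the Hermite-Biehler class; it is smaller than 1 off the real line,
  whereas \<open>\<bar>F (- z)\<bar> = \<bar>F z\<bar>\<close> for a trivial \<open>F\<close>, so \<open>F\<close> is not trivial.

  The zeros are controlled by a local argument. Near a zero of order \<open>k\<close>, the values of \<open>G\<close> turn \<open>k\<close>
  times as fast as the argument of \<open>z\<close>, so the real part is negative somewhere in every closed
  sector of opening \<open>2 \<pi> / k\<close>. As \<open>Re G\<close> is nonnegative on the closed lower half-plane, \<open>G\<close> has no
  zero in the interior and no multiple zero on the boundary, and \<open>F\<close> has the same zeros as \<open>G\<close>
  (\<open>zeros_of_Re_nonneg_lower_half_plane\<close>).

  The Stieltjes integrals that occur have smooth integrands. For these, integration by parts
  compares each Riemann sum with an ordinary integral and bounds the error by a multiple of the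
  mesh (\<open>stieltjes_sum_error\<close>). This gives the existence of the integrals, and because the bound is locally
  uniform in \<open>z\<close> it shows that \<open>F\<close> is entire (\<open>fourier_stieltjes_entire\<close>).
\<close>

section \<open>Functions of bounded variation\<close>

text \<open>
  \<open>V x\<close> is the total variation of \<open>\<mu>\<close> on \<open>[a, x]\<close>: a division of \<open>[a, x]\<close> is extended to one of
  \<open>[a, y]\<close> by the cell \<open>[x, y]\<close>. Everything below uses bounded variation only through such a
  dominating \<open>V\<close>, whose increments telescope over a tagged division.
\<close>

lemma bounded_variation_on_dominated:
  assumes "bounded_variation_on \<mu> a b"
  obtains V where "\<And>x y. a \<le> x \<Longrightarrow> x \<le> y \<Longrightarrow> y \<le> b \<Longrightarrow> \<bar>\<mu> y - \<mu> x\<bar> \<le> V y - V x"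
proof -
  let ?s = "\<lambda>d. \<Sum>K\<in>d. \<bar>\<mu> (Sup K) - \<mu> (Inf K)\<bar>"
  obtain B where B: "\<And>d. d division_of {a..b} \<Longrightarrow> ?s d \<le> B"
    using assms unfolding bounded_variation_on_def by blast
  define V where "V = (\<lambda>x. SUP d\<in>{d. d division_of {a..x}}. ?s d)"
  have extend: "\<exists>d'. d' division_of {a..y} \<and> ?s d' = ?s d + \<bar>\<mu> y - \<mu> x\<bar>"
    if d: "d division_of {a..x}" and xy: "a \<le> x" "x \<le> y" for d x y
  proof (cases "x = y")
    case True
    then show ?thesis using d by auto
  next
    case False
    \<comment> \<open>The new cell has to be a new member of the set of cells, or its increment would not be added.\<close>
    have "{x..y} \<notin> d"
    proof
      assume "{x..y} \<in> d"
      then have "y \<in> {a..x}" using division_ofD(2)[OF d, of "{x..y}"] xy by auto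
      with xy False show False by simp
    qed
    moreover have "(d \<union> {{x..y}}) division_of ({a..x} \<union> {x..y})"
      using d xy division_of_self[of x y] by (intro division_disjoint_union) auto
    moreover have "{a..x} \<union> {x..y} = {a..y}"
      using xy by auto
    ultimately show ?thesis
      using division_of_finite[OF d] xy by (intro exI[of _ "insert {x..y} d"]) auto
  qed
  show thesis
  proof (rule that)
    fix x y :: real
    assume xy: "a \<le> x" "x \<le> y" "y \<le> b"
    have "?s d \<le> B" if "d division_of {a..y}" for d
      using extend[OF that, of b] xy B by fastforce
    then have bdd: "bdd_above (?s ` {d. d division_of {a..y}})"
      by (intro bdd_aboveI[of _ B]) blast
    have "V x \<le> V y - \<bar>\<mu> y - \<mu> x\<bar>"
      unfolding V_def
    proof (rule cSUP_least)
      show "{d. d division_of {a..x}} \<noteq> {}"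
        using division_of_self[of a x] xy by auto
      fix d assume "d \<in> {d. d division_of {a..x}}"
      then obtain d' where d': "d' division_of {a..y}" "?s d' = ?s d + \<bar>\<mu> y - \<mu> x\<bar>"
        using extend[of d x y] xy by auto
      have "?s d' \<le> (SUP d\<in>{d. d division_of {a..y}}. ?s d)"
        using d'(1) bdd by (intro cSUP_upper) auto
      with d'(2) show "?s d \<le> (SUP d\<in>{d. d division_of {a..y}}. ?s d) - \<bar>\<mu> y - \<mu> x\<bar>"
        by linarith
    qed
    then show "\<bar>\<mu> y - \<mu> x\<bar> \<le> V y - V x" by linarith
  qed
qed

text \<open>
  Both \<open>V\<close> and \<open>V - \<mu>\<close> are monotone (the Jordan decomposition of \<open>\<mu>\<close>), so \<open>\<mu>\<close> is measurable, and
  it is bounded.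
\<close>

lemma dominated_times_continuous_integrable:
  fixes g :: "real \<Rightarrow> 'a::euclidean_space"
  assumes dom: "\<And>x y. a \<le> x \<Longrightarrow> x \<le> y \<Longrightarrow> y \<le> b \<Longrightarrow> \<bar>\<mu> y - \<mu> x\<bar> \<le> V y - V x"
    and g: "continuous_on {a..b} g"
  shows "(\<lambda>t. \<mu> t *\<^sub>R g t) integrable_on {a..b}"
proof -
  have meas: "h \<in> borel_measurable (lebesgue_on {a..b})" if "mono_on {a..b} h" for h :: "real \<Rightarrow> real"
    using borel_measurable_mono_on_fnc[OF that]
    by (metis borel_measurable_subalgebra mono_restrict_space sets_completionI_sets
          space_lborel space_completion space_restrict_space sets_lborel subsetI)
  have "mono_on {a..b} V"
    using dom by (intro mono_onI) (force intro: order_trans[OF abs_ge_zero])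
  moreover have "mono_on {a..b} (\<lambda>x. V x - \<mu> x)"
    using dom by (intro mono_onI) (fastforce simp: abs_le_iff)
  ultimately have "(\<lambda>x. V x - (V x - \<mu> x)) \<in> borel_measurable (lebesgue_on {a..b})"
    by (intro borel_measurable_diff meas)
  then have "\<mu> \<in> borel_measurable (lebesgue_on {a..b})"
    by simp
  moreover have "bounded (\<mu> ` {a..b})"
  proof -
    have "\<bar>\<mu> x\<bar> \<le> \<bar>\<mu> a\<bar> + (V b - V a)" if "x \<in> {a..b}" for x
      using dom[of a x] dom[of x b] that by auto
    then show ?thesis unfolding bounded_iff by (metis image_iff real_norm_def)
  qed
  moreover have "g absolutely_integrable_on {a..b}"
    using g by (rule absolutely_integrable_continuous_real)
  ultimately have "(\<lambda>t. \<mu> t *\<^sub>R g t) absolutely_integrable_on {a..b}"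
    using absolutely_integrable_bounded_measurable_product[of "(*\<^sub>R)" \<mu> "{a..b}" g]
      bounded_bilinear_scaleR by (simp add: bilinear_conv_bounded_bilinear)
  then show ?thesis
    using absolutely_integrable_on_def by blast
qed

section \<open>Stieltjes integrals of smooth functions\<close>

text \<open>
  On a cell \<open>[u, v]\<close> with tag \<open>t\<close>, the term of the Riemann sum differs from its counterpart after
  integration by parts by the integral of \<open>(\<mu> s - \<mu> u) f' s\<close> over \<open>[u, t]\<close> and of
  \<open>(\<mu> s - \<mu> v) f' s\<close> over \<open>[t, v]\<close>. These are at most \<open>M (v - u)\<close> times the increments of
  \<open>V\<close>, which add up to \<open>V b - V a\<close>. The explicit bound, rather than mere convergence, is what yields
  uniformity in a parameter.
\<close>

lemma stieltjes_sum_error: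
  fixes f f' :: "real \<Rightarrow> 'a::euclidean_space"
  assumes ab: "a \<le> b"
    and dom: "\<And>x y. a \<le> x \<Longrightarrow> x \<le> y \<Longrightarrow> y \<le> b \<Longrightarrow> \<bar>\<mu> y - \<mu> x\<bar> \<le> V y - V x"
    and f: "\<And>t. t \<in> {a..b} \<Longrightarrow> (f has_vector_derivative f' t) (at t within {a..b})"
    and f': "continuous_on {a..b} f'"
    and M: "\<And>t. t \<in> {a..b} \<Longrightarrow> norm (f' t) \<le> M"
    and p: "p tagged_division_of {a..b}" "\<forall>(t, K)\<in>p. Sup K - Inf K \<le> \<delta>"
  shows "norm ((\<Sum>(t, K)\<in>p. (\<mu> (Sup K) - \<mu> (Inf K)) *\<^sub>R f t)
            - (\<mu> b *\<^sub>R f b - \<mu> a *\<^sub>R f a - integral {a..b} (\<lambda>t. \<mu> t *\<^sub>R f' t)))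
         \<le> M * \<delta> * (V b - V a)"
proof -
  note int = dominated_times_continuous_integrable[of a b \<mu> V f', OF dom f']
  have M0: "0 \<le> M" using order_trans[OF norm_ge_zero M[of a]] ab by simp
  have sub: "norm (integral {x..y} (\<lambda>s. \<mu> s *\<^sub>R f' s) - c *\<^sub>R (f y - f x)) \<le> M * (y - x) * W"
    if xy: "a \<le> x" "x \<le> y" "y \<le> b"
      and W: "\<And>s. s \<in> {x..y} \<Longrightarrow> \<bar>\<mu> s - c\<bar> \<le> W" for x y c W
  proof -
    have le: "{x..y} \<subseteq> {a..b}" using xy by auto
    have W0: "0 \<le> W" using order_trans[OF abs_ge_zero W[of x]] xy by simp
    have i1: "(\<lambda>s. \<mu> s *\<^sub>R f' s) integrable_on {x..y}"
      using int le by (rule integrable_on_subinterval)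
    have i2: "(f' has_integral (f y - f x)) {x..y}"
      using xy by (intro fundamental_theorem_of_calculus)
        (auto intro!: has_vector_derivative_within_subset[OF f le])
    have i3: "((\<lambda>s. (\<mu> s - c) *\<^sub>R f' s) has_integral
        integral {x..y} (\<lambda>s. \<mu> s *\<^sub>R f' s) - c *\<^sub>R (f y - f x)) {x..y}"
      using has_integral_diff[OF integrable_integral[OF i1] has_integral_cmul[OF i2, of c]]
      by (simp add: scaleR_left_diff_distrib)
    have "norm (integral {x..y} (\<lambda>s. \<mu> s *\<^sub>R f' s) - c *\<^sub>R (f y - f x)) \<le> (W * M) * measure lborel {x..y}"
    proof (rule has_integral_bound_real[OF _ finite.emptyI i3])
      show "0 \<le> W * M" using W0 M0 by simp
      show "norm ((\<mu> s - c) *\<^sub>R f' s) \<le> W * M" if "s \<in> {x..y} - {}" for s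
        using that W[of s] M[of s] le W0 by (auto intro!: mult_mono)
    qed
    then show ?thesis using xy by (simp add: mult_ac)
  qed
  have cell: "norm ((\<mu> v - \<mu> u) *\<^sub>R f t - (\<mu> v *\<^sub>R f v - \<mu> u *\<^sub>R f u
                 - integral {u..v} (\<lambda>s. \<mu> s *\<^sub>R f' s))) \<le> M * \<delta> * (V v - V u)"
    if uv: "a \<le> u" "u \<le> t" "t \<le> v" "v \<le> b" and \<delta>: "v - u \<le> \<delta>" for u t v
  proof -
    have "{u..v} \<subseteq> {a..b}" using uv by auto
    then have iu: "(\<lambda>s. \<mu> s *\<^sub>R f' s) integrable_on {u..v}"
      using int by (blast intro: integrable_on_subinterval)
    have split: "integral {u..v} (\<lambda>s. \<mu> s *\<^sub>R f' s)
        = integral {u..t} (\<lambda>s. \<mu> s *\<^sub>R f' s) + integral {t..v} (\<lambda>s. \<mu> s *\<^sub>R f' s)"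
      using Henstock_Kurzweil_Integration.integral_combine[OF uv(2,3) iu] by simp
    have mono: "V x \<le> V y" if "a \<le> x" "x \<le> y" "y \<le> b" for x y
      using dom[OF that] by linarith
    have "norm (integral {u..t} (\<lambda>s. \<mu> s *\<^sub>R f' s) - \<mu> u *\<^sub>R (f t - f u)) \<le> M * (t - u) * (V t - V u)"
    proof (rule sub)
      show "\<bar>\<mu> s - \<mu> u\<bar> \<le> V t - V u" if "s \<in> {u..t}" for s
        using dom[of u s] mono[of s t] that uv by auto
    qed (use uv in auto)
    also have "\<dots> \<le> M * \<delta> * (V t - V u)"
      using uv \<delta> M0 mono[of u t] by (intro mult_right_mono mult_left_mono) auto
    finally have 1: "norm (integral {u..t} (\<lambda>s. \<mu> s *\<^sub>R f' s) - \<mu> u *\<^sub>R (f t - f u))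
        \<le> M * \<delta> * (V t - V u)" .
    have "norm (integral {t..v} (\<lambda>s. \<mu> s *\<^sub>R f' s) - \<mu> v *\<^sub>R (f v - f t)) \<le> M * (v - t) * (V v - V t)"
    proof (rule sub)
      show "\<bar>\<mu> s - \<mu> v\<bar> \<le> V v - V t" if "s \<in> {t..v}" for s
        using dom[of s v] mono[of t s] that uv by auto
    qed (use uv in auto)
    also have "\<dots> \<le> M * \<delta> * (V v - V t)"
      using uv \<delta> M0 mono[of t v] by (intro mult_right_mono mult_left_mono) auto
    finally have 2: "norm (integral {t..v} (\<lambda>s. \<mu> s *\<^sub>R f' s) - \<mu> v *\<^sub>R (f v - f t))
        \<le> M * \<delta> * (V v - V t)" .
    have "(\<mu> v - \<mu> u) *\<^sub>R f t - (\<mu> v *\<^sub>R f v - \<mu> u *\<^sub>R f u - integral {u..v} (\<lambda>s. \<mu> s *\<^sub>R f' s))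
        = (integral {u..t} (\<lambda>s. \<mu> s *\<^sub>R f' s) - \<mu> u *\<^sub>R (f t - f u))
        + (integral {t..v} (\<lambda>s. \<mu> s *\<^sub>R f' s) - \<mu> v *\<^sub>R (f v - f t))"
      unfolding split by (simp add: algebra_simps)
    also have "norm \<dots> \<le> M * \<delta> * (V t - V u) + M * \<delta> * (V v - V t)"
      using 1 2 by (rule norm_triangle_mono)
    finally show ?thesis by (simp add: algebra_simps)
  qed
  let ?c = "\<lambda>(t, K). \<mu> (Sup K) *\<^sub>R f (Sup K) - \<mu> (Inf K) *\<^sub>R f (Inf K) - integral K (\<lambda>s. \<mu> s *\<^sub>R f' s)"
  have "\<mu> b *\<^sub>R f b - \<mu> a *\<^sub>R f a - integral {a..b} (\<lambda>t. \<mu> t *\<^sub>R f' t) = (\<Sum>x\<in>p. ?c x)"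
    using additive_tagged_division_1[OF ab p(1), of "\<lambda>t. \<mu> t *\<^sub>R f t"]
      integral_combine_tagged_division_topdown[of "\<lambda>t. \<mu> t *\<^sub>R f' t" a b p] int p(1)
    by (simp add: sum_subtractf case_prod_unfold)
  then have "(\<Sum>(t, K)\<in>p. (\<mu> (Sup K) - \<mu> (Inf K)) *\<^sub>R f t)
            - (\<mu> b *\<^sub>R f b - \<mu> a *\<^sub>R f a - integral {a..b} (\<lambda>t. \<mu> t *\<^sub>R f' t))
        = (\<Sum>(t, K)\<in>p. (\<mu> (Sup K) - \<mu> (Inf K)) *\<^sub>R f t - ?c (t, K))"
    by (simp add: sum_subtractf case_prod_unfold)
  also have "norm \<dots> \<le> (\<Sum>(t, K)\<in>p. M * \<delta> * (V (Sup K) - V (Inf K)))"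
  proof (rule sum_norm_le)
    fix x assume "x \<in> p"
    then obtain t K where tK: "(t, K) \<in> p" "x = (t, K)" by (cases x) auto
    obtain u v where K: "K = {u..v}"
      using tagged_division_ofD(4)[OF p(1) tK(1)] by auto
    have "t \<in> {u..v}" "{u..v} \<subseteq> {a..b}"
      using tagged_division_ofD(2,3)[OF p(1) tK(1)] K by auto
    moreover from this have "Sup K = v" "Inf K = u" using K by auto
    moreover have "Sup K - Inf K \<le> \<delta>" using p(2) tK by auto
    ultimately show "norm (case x of (t, K) \<Rightarrow> (\<mu> (Sup K) - \<mu> (Inf K)) *\<^sub>R f t - ?c (t, K))
        \<le> (case x of (t, K) \<Rightarrow> M * \<delta> * (V (Sup K) - V (Inf K)))"
      using cell[of u t v] K tK(2) by auto
  qed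
  also have "\<dots> = M * \<delta> * (V b - V a)"
    using additive_tagged_division_1[OF ab p(1), of V]
    by (simp add: sum_distrib_left[symmetric] case_prod_unfold)
  finally show ?thesis .
qed

lemma has_stieltjes_integral_by_parts:
  fixes f f' :: "real \<Rightarrow> 'a::euclidean_space"
  assumes ab: "a \<le> b"
    and dom: "\<And>x y. a \<le> x \<Longrightarrow> x \<le> y \<Longrightarrow> y \<le> b \<Longrightarrow> \<bar>\<mu> y - \<mu> x\<bar> \<le> V y - V x"
    and f: "\<And>t. t \<in> {a..b} \<Longrightarrow> (f has_vector_derivative f' t) (at t within {a..b})"
    and f': "continuous_on {a..b} f'"
  shows "has_stieltjes_integral f \<mu> a b
           (\<mu> b *\<^sub>R f b - \<mu> a *\<^sub>R f a - integral {a..b} (\<lambda>t. \<mu> t *\<^sub>R f' t))"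
  unfolding has_stieltjes_integral_def
proof (intro allI impI)
  fix e :: real assume "e > 0"
  obtain M where M: "M > 0" "\<And>t. t \<in> {a..b} \<Longrightarrow> norm (f' t) \<le> M"
    using compact_imp_bounded[OF compact_continuous_image[OF f' compact_Icc]]
    by (auto simp: bounded_pos)
  \<comment> \<open>The summand 1 avoids a division by zero when the variation vanishes.\<close>
  define V' where "V' = V b - V a + 1"
  have V': "V' > 0" "V b - V a < V'" using dom[of a b] ab by (auto simp: V'_def)
  define \<delta> where "\<delta> = e / (M * V')"
  have \<delta>: "\<delta> > 0" using \<open>e > 0\<close> M(1) V' by (simp add: \<delta>_def)
  show "\<exists>\<delta>>0. \<forall>p. p tagged_division_of {a..b} \<and> (\<forall>(t, K)\<in>p. Sup K - Inf K < \<delta>) \<longrightarrow>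
        norm ((\<Sum>(t, K)\<in>p. (\<mu> (Sup K) - \<mu> (Inf K)) *\<^sub>R f t)
            - (\<mu> b *\<^sub>R f b - \<mu> a *\<^sub>R f a - integral {a..b} (\<lambda>t. \<mu> t *\<^sub>R f' t))) < e"
  proof (intro exI[of _ \<delta>] conjI allI impI \<delta>)
    fix p assume "p tagged_division_of {a..b} \<and> (\<forall>(t, K)\<in>p. Sup K - Inf K < \<delta>)"
    then have p: "p tagged_division_of {a..b}" "\<forall>(t, K)\<in>p. Sup K - Inf K \<le> \<delta>"
      by (auto intro: less_imp_le)
    have "M * \<delta> * (V b - V a) < M * \<delta> * V'"
      using M(1) \<delta> V' by (intro mult_strict_left_mono) auto
    also have "\<dots> = e" using M(1) V' by (simp add: \<delta>_def)
    finally show "norm ((\<Sum>(t, K)\<in>p. (\<mu> (Sup K) - \<mu> (Inf K)) *\<^sub>R f t)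
            - (\<mu> b *\<^sub>R f b - \<mu> a *\<^sub>R f a - integral {a..b} (\<lambda>t. \<mu> t *\<^sub>R f' t))) < e"
      using stieltjes_sum_error[of a b \<mu> V f f' M p \<delta>, OF ab dom f f' M(2) p] by (rule le_less_trans[rotated])
  qed
qed

text \<open>
  The reversal of orientation produces the sign. After integration by parts on both sides this is
  the substitution \<open>t \<mapsto> b - t\<close> in an ordinary integral, for which no divisions have to be
  transported.
\<close>

lemma stieltjes_integral_reflect:
  fixes f f' :: "real \<Rightarrow> 'a::euclidean_space"
  assumes ab: "0 \<le> b"
    and dom: "\<And>x y. 0 \<le> x \<Longrightarrow> x \<le> y \<Longrightarrow> y \<le> b \<Longrightarrow> \<bar>\<mu> y - \<mu> x\<bar> \<le> V y - V x"
    and f: "\<And>t. (f has_vector_derivative f' t) (at t)"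
    and f': "continuous_on UNIV f'"
  shows "stieltjes_integral 0 b f (\<lambda>t. \<mu> (b - t)) = - stieltjes_integral 0 b (\<lambda>t. f (b - t)) \<mu>"
proof -
  have "has_stieltjes_integral f (\<lambda>t. \<mu> (b - t)) 0 b
     (\<mu> (b - b) *\<^sub>R f b - \<mu> (b - 0) *\<^sub>R f 0 - integral {0..b} (\<lambda>t. \<mu> (b - t) *\<^sub>R f' t))"
  proof (rule has_stieltjes_integral_by_parts[OF ab])
    show "\<bar>\<mu> (b - y) - \<mu> (b - x)\<bar> \<le> - V (b - y) - (- V (b - x))"
      if "0 \<le> x" "x \<le> y" "y \<le> b" for x y
      using dom[of "b - y" "b - x"] that by (simp add: abs_minus_commute)
  qed (use f f' in \<open>auto intro: has_vector_derivative_at_within continuous_on_subset\<close>)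
  moreover have "has_stieltjes_integral (\<lambda>t. f (b - t)) \<mu> 0 b
     (\<mu> b *\<^sub>R f (b - b) - \<mu> 0 *\<^sub>R f (b - 0) - integral {0..b} (\<lambda>t. \<mu> t *\<^sub>R - f' (b - t)))"
  proof (rule has_stieltjes_integral_by_parts[OF ab dom])
    show "((\<lambda>t. f (b - t)) has_vector_derivative - f' (b - t)) (at t within {0..b})" for t
    proof -
      have "((\<lambda>t. b - t) has_vector_derivative -1) (at t)"
        by (auto intro!: derivative_eq_intros)
      from vector_diff_chain_at[OF this f] show ?thesis
        by (simp add: o_def has_vector_derivative_at_within)
    qed
    show "continuous_on {0..b} (\<lambda>t. - f' (b - t))"
      by (intro continuous_on_minus continuous_on_compose2[OF f'] continuous_intros) auto
  qed
  moreover have "integral {0..b} (\<lambda>t. \<mu> t *\<^sub>R - f' (b - t)) = - integral {0..b} (\<lambda>t. \<mu> (b - t) *\<^sub>R f' t)"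
  proof -
    have "(\<lambda>t. \<mu> t *\<^sub>R f' (b - t)) integrable_on {0..b}"
      by (rule dominated_times_continuous_integrable[OF dom])
        (auto intro!: continuous_on_compose2[OF f'] continuous_intros)
    then have "((\<lambda>t. \<mu> t *\<^sub>R f' (b - t)) has_integral integral {0..b} (\<lambda>t. \<mu> t *\<^sub>R f' (b - t))) (cbox 0 b)"
      by (simp add: integrable_integral)
    from has_integral_affinity[OF this, of "-1" b]
    have "((\<lambda>t. \<mu> (b - t) *\<^sub>R f' t) has_integral integral {0..b} (\<lambda>t. \<mu> t *\<^sub>R f' (b - t))) {0..b}"
      using ab by (simp add: image_affinity_atLeastAtMost_diff)
    then show ?thesis by (simp add: integral_unique)
  qed
  ultimately show ?thesis
    by (simp add: stieltjes_integral_eqI)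
qed

lemma has_stieltjes_integral_add:
  assumes "has_stieltjes_integral f \<mu> a b I" "has_stieltjes_integral g \<mu> a b J"
  shows "has_stieltjes_integral (\<lambda>t. f t + g t) \<mu> a b (I + J)"
  unfolding has_stieltjes_integral_def
proof (intro allI impI)
  fix e :: real assume "e > 0"
  let ?S = "\<lambda>h p. \<Sum>(t, K)\<in>p. (\<mu> (Sup K) - \<mu> (Inf K)) *\<^sub>R h t"
  obtain d1 where d1: "d1 > 0" "\<And>p. p tagged_division_of {a..b} \<Longrightarrow>
      (\<forall>(t, K)\<in>p. Sup K - Inf K < d1) \<Longrightarrow> norm (?S f p - I) < e / 2"
    using assms(1)[unfolded has_stieltjes_integral_def, rule_format, of "e / 2"] \<open>e > 0\<close> by auto
  obtain d2 where d2: "d2 > 0" "\<And>p. p tagged_division_of {a..b} \<Longrightarrow>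
      (\<forall>(t, K)\<in>p. Sup K - Inf K < d2) \<Longrightarrow> norm (?S g p - J) < e / 2"
    using assms(2)[unfolded has_stieltjes_integral_def, rule_format, of "e / 2"] \<open>e > 0\<close> by auto
  show "\<exists>\<delta>>0. \<forall>p. p tagged_division_of {a..b} \<and> (\<forall>(t, K)\<in>p. Sup K - Inf K < \<delta>) \<longrightarrow>
        norm (?S (\<lambda>t. f t + g t) p - (I + J)) < e"
  proof (intro exI[of _ "min d1 d2"] conjI allI impI)
    fix p assume p: "p tagged_division_of {a..b} \<and> (\<forall>(t, K)\<in>p. Sup K - Inf K < min d1 d2)"
    then have 1: "norm (?S f p - I) < e / 2" and 2: "norm (?S g p - J) < e / 2"
      by (intro d1(2) d2(2); force)+
    have "?S (\<lambda>t. f t + g t) p - (I + J) = (?S f p - I) + (?S g p - J)"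
      by (simp add: case_prod_unfold scaleR_add_right sum.distrib)
    also have "norm \<dots> < e / 2 + e / 2"
      using 1 2 by (rule norm_triangle_lt[OF add_strict_mono])
    finally show "norm (?S (\<lambda>t. f t + g t) p - (I + J)) < e"
      by simp
  qed (use d1 d2 in simp)
qed

lemma has_stieltjes_integral_bounded_linear:
  assumes "bounded_linear T" and I: "has_stieltjes_integral f \<mu> a b I"
  shows "has_stieltjes_integral (\<lambda>t. T (f t)) \<mu> a b (T I)"
  unfolding has_stieltjes_integral_def
proof (intro allI impI)
  interpret T: bounded_linear T by fact
  fix e :: real assume "e > 0"
  let ?S = "\<lambda>p. \<Sum>(t, K)\<in>p. (\<mu> (Sup K) - \<mu> (Inf K)) *\<^sub>R f t"
  obtain B where B: "B > 0" "\<And>x. norm (T x) \<le> norm x * B"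
    using T.pos_bounded by blast
  obtain d where d: "d > 0" "\<And>p. p tagged_division_of {a..b} \<Longrightarrow>
      (\<forall>(t, K)\<in>p. Sup K - Inf K < d) \<Longrightarrow> norm (?S p - I) < e / B"
    using I[unfolded has_stieltjes_integral_def, rule_format, of "e / B"] \<open>e > 0\<close> B(1) by auto
  show "\<exists>\<delta>>0. \<forall>p. p tagged_division_of {a..b} \<and> (\<forall>(t, K)\<in>p. Sup K - Inf K < \<delta>) \<longrightarrow>
        norm ((\<Sum>(t, K)\<in>p. (\<mu> (Sup K) - \<mu> (Inf K)) *\<^sub>R T (f t)) - T I) < e"
  proof (intro exI[of _ d] conjI allI impI d(1))
    fix p assume p: "p tagged_division_of {a..b} \<and> (\<forall>(t, K)\<in>p. Sup K - Inf K < d)"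
    have "(\<Sum>(t, K)\<in>p. (\<mu> (Sup K) - \<mu> (Inf K)) *\<^sub>R T (f t)) - T I = T (?S p - I)"
      by (simp add: T.diff T.sum T.scaleR case_prod_unfold)
    moreover have "norm (?S p - I) * B < e"
      using d(2)[of p] p B(1) by (simp add: pos_less_divide_eq)
    ultimately show "norm ((\<Sum>(t, K)\<in>p. (\<mu> (Sup K) - \<mu> (Inf K)) *\<^sub>R T (f t)) - T I) < e"
      using B(2)[of "?S p - I"] by (auto intro: le_less_trans)
  qed
qed

lemma tagged_division_fine_mesh_sequence:
  fixes a b :: real
  obtains p where "\<And>n::nat. p n tagged_division_of {a..b}"
    "\<And>n. \<forall>(t, K)\<in>p n. Sup K - Inf K < inverse (real (Suc n))"
proof -
  have "\<exists>p. p tagged_division_of {a..b} \<and> (\<forall>(t, K)\<in>p. Sup K - Inf K < \<delta>)" if "\<delta> > 0" for \<delta>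
  proof -
    have "gauge (\<lambda>x::real. ball x (\<delta> / 2))"
      using that by (intro gaugeI) auto
    then obtain p where p: "p tagged_division_of {a..b}" "(\<lambda>x. ball x (\<delta> / 2)) fine p"
      using fine_division_exists_real by blast
    have "Sup K - Inf K < \<delta>" if tK: "(t, K) \<in> p" for t K
    proof -
      obtain u v where K: "K = {u..v}" "u \<le> v"
        using tagged_division_ofD(2,4)[OF p(1) tK] by auto
      have "K \<subseteq> ball t (\<delta> / 2)" using p(2) tK by (rule fineD)
      then have "u \<in> ball t (\<delta> / 2)" "v \<in> ball t (\<delta> / 2)" using K by auto
      then have "\<bar>t - u\<bar> < \<delta> / 2" "\<bar>t - v\<bar> < \<delta> / 2" by (simp_all add: dist_real_def)
      then have "v - u < \<delta>" by linarith
      then show ?thesis using K by simp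
    qed
    with p(1) show ?thesis by blast
  qed
  then have "\<forall>n::nat. \<exists>p. p tagged_division_of {a..b} \<and>
      (\<forall>(t, K)\<in>p. Sup K - Inf K < inverse (real (Suc n)))"
    by simp
  then show thesis using that by metis
qed

text \<open>
  The Riemann sums satisfy this bound, because the increments of \<open>\<mu>\<close> are dominated by those of \<open>V\<close>.
\<close>

lemma norm_stieltjes_integral_le:
  assumes ab: "a \<le> b"
    and dom: "\<And>x y. a \<le> x \<Longrightarrow> x \<le> y \<Longrightarrow> y \<le> b \<Longrightarrow> \<bar>\<mu> y - \<mu> x\<bar> \<le> V y - V x"
    and I: "has_stieltjes_integral f \<mu> a b I"
    and M: "\<And>t. t \<in> {a..b} \<Longrightarrow> norm (f t) \<le> M"
  shows "norm I \<le> M * (V b - V a)"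
proof (rule field_le_epsilon)
  fix e :: real assume "e > 0"
  then obtain d where d: "d > 0" "\<And>p. p tagged_division_of {a..b} \<Longrightarrow>
      (\<forall>(t, K)\<in>p. Sup K - Inf K < d) \<Longrightarrow>
      norm ((\<Sum>(t, K)\<in>p. (\<mu> (Sup K) - \<mu> (Inf K)) *\<^sub>R f t) - I) < e"
    using I[unfolded has_stieltjes_integral_def, rule_format, of e] by auto
  obtain q where q: "\<And>n::nat. q n tagged_division_of {a..b}"
    "\<And>n. \<forall>(t, K)\<in>q n. Sup K - Inf K < inverse (real (Suc n))"
    using tagged_division_fine_mesh_sequence[of a b] by blast
  obtain n where "inverse (real (Suc n)) < d" using reals_Archimedean[OF d(1)] by auto
  then have p: "q n tagged_division_of {a..b}" "\<forall>(t, K)\<in>q n. Sup K - Inf K < d"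
    using q[of n] by (auto intro: less_trans)
  have "norm (\<Sum>(t, K)\<in>q n. (\<mu> (Sup K) - \<mu> (Inf K)) *\<^sub>R f t)
      \<le> (\<Sum>(t, K)\<in>q n. M * (V (Sup K) - V (Inf K)))"
  proof (rule sum_norm_le)
    fix x assume "x \<in> q n"
    then obtain t K where tK: "(t, K) \<in> q n" "x = (t, K)" by (cases x) auto
    obtain u v where K: "K = {u..v}"
      using tagged_division_ofD(4)[OF p(1) tK(1)] by auto
    have uv: "t \<in> {u..v}" "{u..v} \<subseteq> {a..b}"
      using tagged_division_ofD(2,3)[OF p(1) tK(1)] K by auto
    then have "\<bar>\<mu> v - \<mu> u\<bar> * norm (f t) \<le> (V v - V u) * M"
      using dom[of u v] M[of t] by (intro mult_mono) auto
    then show "norm (case x of (t, K) \<Rightarrow> (\<mu> (Sup K) - \<mu> (Inf K)) *\<^sub>R f t)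
        \<le> (case x of (t, K) \<Rightarrow> M * (V (Sup K) - V (Inf K)))"
      using uv K tK(2) by (simp add: mult.commute)
  qed
  also have "\<dots> = M * (V b - V a)"
    using additive_tagged_division_1[OF ab p(1), of V]
    by (simp add: sum_distrib_left[symmetric] case_prod_unfold)
  finally show "norm I \<le> M * (V b - V a) + e"
    using d(2)[OF p] norm_triangle_sub[of I "\<Sum>(t, K)\<in>q n. (\<mu> (Sup K) - \<mu> (Inf K)) *\<^sub>R f t"]
    by (simp add: norm_minus_commute)
qed

section \<open>The Fourier-Stieltjes transform\<close>

lemma has_stieltjes_integral_exp:
  assumes "a \<le> b"
    and dom: "\<And>x y. a \<le> x \<Longrightarrow> x \<le> y \<Longrightarrow> y \<le> b \<Longrightarrow> \<bar>\<mu> y - \<mu> x\<bar> \<le> V y - V x"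
  shows "has_stieltjes_integral (\<lambda>t. exp (\<i> * z * of_real t)) \<mu> a b
           (stieltjes_integral a b (\<lambda>t. exp (\<i> * z * of_real t)) \<mu>)"
proof -
  have der: "((\<lambda>t. exp (\<i> * z * of_real t)) has_vector_derivative \<i> * z * exp (\<i> * z * of_real t))
      (at t within {a..b})" for t
    by (auto intro!: derivative_eq_intros has_vector_derivative_real_field)
  have cont: "continuous_on {a..b} (\<lambda>t. \<i> * z * exp (\<i> * z * of_real t))"
    by (intro continuous_intros)
  have "\<exists>I. has_stieltjes_integral (\<lambda>t. exp (\<i> * z * of_real t)) \<mu> a b I"
    by (rule exI, rule has_stieltjes_integral_by_parts[where \<mu> = \<mu> and V = V, OF assms(1) dom der cont])
  then show ?thesis
    using stieltjes_integral_eqI by blast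
qed

text \<open>
  Riemann sums of a fixed division are finite sums of exponentials in \<open>z\<close>. By
  \<open>stieltjes_sum_error\<close>, along a sequence of divisions with mesh tending to 0 they converge uniformly
  on discs, since the derivative of the integrand in \<open>t\<close> is at most \<open>R exp (R c)\<close> for \<open>\<bar>z\<bar> \<le> R\<close>,
  where \<open>c\<close> is the larger of \<open>\<bar>a\<bar>\<close> and \<open>\<bar>b\<bar>\<close>.
\<close>

lemma fourier_stieltjes_entire:
  assumes ab: "a \<le> b"
    and dom: "\<And>x y. a \<le> x \<Longrightarrow> x \<le> y \<Longrightarrow> y \<le> b \<Longrightarrow> \<bar>\<mu> y - \<mu> x\<bar> \<le> V y - V x"
  shows "(\<lambda>z. stieltjes_integral a b (\<lambda>t. exp (\<i> * z * of_real t)) \<mu>) holomorphic_on UNIV"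
proof -
  obtain p where p: "\<And>n::nat. p n tagged_division_of {a..b}"
    "\<And>n. \<forall>(t, K)\<in>p n. Sup K - Inf K < inverse (real (Suc n))"
    using tagged_division_fine_mesh_sequence[of a b] by blast
  define F where "F = (\<lambda>z. stieltjes_integral a b (\<lambda>t. exp (\<i> * z * of_real t)) \<mu>)"
  define S where "S = (\<lambda>n z. \<Sum>(t, K)\<in>p n. (\<mu> (Sup K) - \<mu> (Inf K)) *\<^sub>R exp (\<i> * z * complex_of_real t))"
  define c where "c = max \<bar>a\<bar> \<bar>b\<bar>"
  have err: "norm (S n z - F z) \<le> (R * exp (R * c)) * inverse (real (Suc n)) * (V b - V a)"
    if z: "norm z \<le> R" for n z R
  proof -
    let ?f = "\<lambda>t. exp (\<i> * z * complex_of_real t)" and ?f' = "\<lambda>t. \<i> * z * exp (\<i> * z * complex_of_real t)"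
    have der: "(?f has_vector_derivative ?f' t) (at t within {a..b})" for t
      by (auto intro!: derivative_eq_intros has_vector_derivative_real_field)
    have cont: "continuous_on {a..b} ?f'"
      by (intro continuous_intros)
    have bnd: "norm (?f' t) \<le> R * exp (R * c)" if "t \<in> {a..b}" for t
    proof -
      have "\<bar>Im z * t\<bar> \<le> R * c"
        unfolding abs_mult using z abs_Im_le_cmod[of z] that
        by (intro mult_mono) (auto simp: c_def)
      then show ?thesis
        using z by (auto simp: norm_mult intro!: mult_mono order_trans[OF norm_ge_zero z])
    qed
    have "\<forall>(t, K)\<in>p n. Sup K - Inf K \<le> inverse (real (Suc n))"
      using p(2)[of n] by (auto intro: less_imp_le)
    moreover have "F z = \<mu> b *\<^sub>R ?f b - \<mu> a *\<^sub>R ?f a - integral {a..b} (\<lambda>t. \<mu> t *\<^sub>R ?f' t)"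
      unfolding F_def
      by (rule stieltjes_integral_eqI, rule has_stieltjes_integral_by_parts[where \<mu> = \<mu> and V = V, OF ab dom der cont])
    ultimately show ?thesis
      unfolding S_def
      using stieltjes_sum_error[of a b \<mu> V ?f ?f', OF ab dom der cont bnd p(1)] by simp
  qed
  have "F holomorphic_on UNIV"
  proof (rule holomorphic_uniform_sequence[of UNIV S F])
    show "S n holomorphic_on UNIV" for n
      unfolding S_def case_prod_unfold by (intro holomorphic_intros)
    fix x :: complex
    define R where "R = norm x + 1"
    define B where "B = (R * exp (R * c)) * (V b - V a)"
    have "uniform_limit (cball x 1) S F sequentially"
    proof (rule uniform_limitI)
      fix e :: real assume "e > 0"
      have "(\<lambda>n. B * inverse (real (Suc n))) \<longlonglongrightarrow> B * 0"
        by (intro tendsto_intros LIMSEQ_inverse_real_of_nat)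
      then have "\<forall>\<^sub>F n in sequentially. B * inverse (real (Suc n)) < e"
        using \<open>e > 0\<close> by (intro order_tendstoD(2)) auto
      then show "\<forall>\<^sub>F n in sequentially. \<forall>z\<in>cball x 1. dist (S n z) (F z) < e"
      proof eventually_elim
        case (elim n)
        show ?case
        proof
          fix z assume "z \<in> cball x 1"
          then have "norm z \<le> R"
            using norm_triangle_sub[of z x] by (simp add: R_def dist_norm norm_minus_commute)
          from err[OF this, of n] elim show "dist (S n z) (F z) < e"
            by (simp add: B_def dist_norm mult_ac)
        qed
      qed
    qed
    then show "\<exists>d>0. cball x d \<subseteq> UNIV \<and> uniform_limit (cball x d) S F sequentially"
      by (intro exI[of _ 1]) simp
  qed simp
  then show ?thesis by (simp add: F_def)
qed

section \<open>Bounded holomorphic functions on the lower half-plane\<close>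

text \<open>
  The Phragmen-Lindelof principle for bounded functions. Division by \<open>1 + \<i> \<epsilon> z\<close>, which has
  modulus at least 1 and at least \<open>\<epsilon> \<bar>z\<bar>\<close> on the half-plane, makes the bound hold on large half-circles
  as well, so the maximum principle applies to half-discs; then \<open>\<epsilon>\<close> tends to 0.
\<close>

lemma phragmen_lindelof_lower_half_plane:
  assumes holf: "f holomorphic_on {z. Im z < 0}"
    and contf: "continuous_on {z. Im z \<le> 0} f"
    and bound: "\<And>z. Im z \<le> 0 \<Longrightarrow> norm (f z) \<le> M"
    and real: "\<And>x::real. norm (f (of_real x)) \<le> B"
    and z: "Im z \<le> 0"
  shows "norm (f z) \<le> B"
proof (rule field_le_epsilon)
  fix d :: real assume "d > 0"
  \<comment> \<open>A positive bound is needed to choose the radius of the half-disc, whereas \<open>B\<close> may be 0.\<close>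
  define B' where "B' = B + d"
  have B': "B' > 0" "B \<le> B'"
    using order_trans[OF norm_ge_zero real[of 0]] \<open>d > 0\<close> by (auto simp: B'_def)
  have damped: "norm (f z) \<le> B' * norm (1 + \<i> * of_real \<epsilon> * z)" if \<epsilon>: "\<epsilon> > 0" for \<epsilon>
  proof -
    define h where "h = (\<lambda>w. f w / (1 + \<i> * of_real \<epsilon> * w))"
    have ge1: "1 \<le> norm (1 + \<i> * of_real \<epsilon> * w)" if "Im w \<le> 0" for w
    proof -
      have "1 \<le> Re (1 + \<i> * of_real \<epsilon> * w)" using that \<epsilon> by (simp add: mult_nonneg_nonpos)
      then show ?thesis using complex_Re_le_cmod order_trans by blast
    qed
    then have nz: "1 + \<i> * of_real \<epsilon> * w \<noteq> 0" if "Im w \<le> 0" for w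
      using that by fastforce
    have ge: "\<epsilon> * norm w \<le> norm (1 + \<i> * of_real \<epsilon> * w)" if "Im w \<le> 0" for w
    proof -
      have "(\<epsilon> * norm w)\<^sup>2 \<le> (1 - \<epsilon> * Im w)\<^sup>2 + (\<epsilon> * Re w)\<^sup>2"
        using mult_nonneg_nonpos[of \<epsilon> "Im w"] that \<epsilon>
        by (simp add: cmod_power2 power_mult_distrib power2_diff algebra_simps)
      also have "\<dots> = (norm (1 + \<i> * of_real \<epsilon> * w))\<^sup>2"
        by (simp add: cmod_power2)
      finally show ?thesis by (rule power2_le_imp_le) simp
    qed
    define R where "R = norm z + \<bar>M\<bar> / (\<epsilon> * B') + 1"
    have R: "norm z \<le> R" "\<bar>M\<bar> / (\<epsilon> * B') \<le> R" "R > 0"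
      using \<epsilon> B' by (auto simp: R_def add_nonneg_pos)
    define S where "S = {w. Im w \<le> 0} \<inter> cball 0 R"
    have "interior {w. Im w \<le> 0} = {w. Im w < 0}"
      using interior_halfspace_le[of \<i> 0] by (simp add: inner_complex_def)
    then have int: "interior S = {w. Im w < 0} \<inter> ball 0 R"
      by (simp add: S_def)
    have "closed S"
      unfolding S_def by (intro closed_Int closed_cball closed_halfspace_Im_le)
    have "norm (h z) \<le> B'"
    proof (rule maximum_modulus_frontier[of h S])
      show "h holomorphic_on interior S"
        unfolding h_def int
        by (intro holomorphic_intros holomorphic_on_subset[OF holf]) (auto simp: nz)
      show "continuous_on (closure S) h"
        unfolding h_def closure_closed[OF \<open>closed S\<close>]
        by (intro continuous_intros continuous_on_subset[OF contf]) (auto simp: S_def nz)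
      show "bounded S" unfolding S_def by (simp add: bounded_Int)
      show "z \<in> S" using z R by (simp add: S_def)
      show "norm (h w) \<le> B'" if "w \<in> frontier S" for w
      proof -
        have w: "w \<in> S" "w \<notin> interior S"
          using that \<open>closed S\<close> by (auto simp: frontier_def)
        then consider "Im w = 0" | "Im w \<le> 0" "norm w = R"
          unfolding int by (fastforce simp: S_def)
        then show ?thesis
        proof cases
          case 1
          then have "norm (f w) \<le> B'"
            using real[of "Re w"] B'(2) complex_is_Real_iff[of w] by (simp add: of_real_Re)
          moreover have "norm (f w) / norm (1 + \<i> * of_real \<epsilon> * w) \<le> norm (f w) / 1"
            using ge1[of w] 1 by (intro divide_left_mono) auto
          ultimately show ?thesis by (simp add: h_def norm_divide)
        next
          case 2
          have "norm (f w) \<le> \<bar>M\<bar>" using bound[of w] 2 by simp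
          also have "\<bar>M\<bar> \<le> B' * (\<epsilon> * norm w)"
            using R \<epsilon> B' 2 by (simp add: field_simps)
          also have "\<dots> \<le> B' * norm (1 + \<i> * of_real \<epsilon> * w)"
            using ge[of w] 2 B' by (intro mult_left_mono) auto
          finally show ?thesis
            using nz[of w] 2 by (simp add: h_def norm_divide divide_le_eq)
        qed
      qed
    qed
    then show ?thesis
      using nz[OF z] by (simp add: h_def norm_divide divide_le_eq)
  qed
  have "norm (f z) \<le> B' * norm (1 + \<i> * of_real 0 * z)"
  proof (rule tendsto_lowerbound)
    show "((\<lambda>\<epsilon>. B' * norm (1 + \<i> * of_real \<epsilon> * z)) \<longlongrightarrow> B' * norm (1 + \<i> * of_real 0 * z)) (at_right 0)"
      by (intro tendsto_intros)
    show "\<forall>\<^sub>F \<epsilon> in at_right 0. norm (f z) \<le> B' * norm (1 + \<i> * of_real \<epsilon> * z)"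
      using damped by (auto simp: eventually_at_right_less intro: eventually_mono[OF eventually_at_right_less])
  qed simp
  then show "norm (f z) \<le> B + d" by (simp add: B'_def)
qed

text \<open>
  The modulus of \<open>exp (- G)\<close> is \<open>exp (- Re G)\<close>, so the claim is an upper bound by 1.
\<close>

lemma Re_nonneg_lower_half_plane:
  assumes "G holomorphic_on {z. Im z < 0}" "continuous_on {z. Im z \<le> 0} G"
    and bound: "\<And>z. Im z \<le> 0 \<Longrightarrow> norm (G z) \<le> M"
    and real: "\<And>x::real. 0 \<le> Re (G (of_real x))"
    and z: "Im z \<le> 0"
  shows "0 \<le> Re (G z)"
proof -
  have "norm (exp (- G z)) \<le> 1"
  proof (rule phragmen_lindelof_lower_half_plane[where f = "\<lambda>w. exp (- G w)", OF _ _ _ _ z])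
    show "norm (exp (- G w)) \<le> exp M" if "Im w \<le> 0" for w
      using bound[OF that] abs_Re_le_cmod[of "G w"] by simp
  qed (use assms in \<open>auto intro!: holomorphic_intros continuous_intros\<close>)
  then show ?thesis by simp
qed

text \<open>
  The quotient \<open>A / G\<close> has modulus at most 1 on the real line but might be unbounded elsewhere, since
  \<open>G\<close> may approach 0. Adding \<open>e > 0\<close> to \<open>G\<close> cures this and, because \<open>Re G \<ge> 0\<close>, does not
  decrease \<open>\<bar>G\<bar>\<close>.
\<close>

lemma norm_le_of_Re_nonneg_lower_half_plane:
  assumes A: "A holomorphic_on {z. Im z < 0}" "continuous_on {z. Im z \<le> 0} A"
    and G: "G holomorphic_on {z. Im z < 0}" "continuous_on {z. Im z \<le> 0} G"
    and bound: "\<And>z. Im z \<le> 0 \<Longrightarrow> norm (A z) \<le> M"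
    and pos: "\<And>z. Im z \<le> 0 \<Longrightarrow> 0 \<le> Re (G z)"
    and real: "\<And>x::real. norm (A (of_real x)) \<le> norm (G (of_real x))"
    and z: "Im z \<le> 0"
  shows "norm (A z) \<le> norm (G z)"
proof (rule field_le_epsilon)
  fix e :: real assume e: "e > 0"
  have ge: "e \<le> norm (G w + of_real e)" if "Im w \<le> 0" for w
    using pos[OF that] complex_Re_le_cmod[of "G w + of_real e"] by simp
  then have nz: "G w + of_real e \<noteq> 0" if "Im w \<le> 0" for w
    using that e by fastforce
  have "norm (A z / (G z + of_real e)) \<le> 1"
  proof (rule phragmen_lindelof_lower_half_plane[where f = "\<lambda>w. A w / (G w + of_real e)", OF _ _ _ _ z])
    show "(\<lambda>w. A w / (G w + of_real e)) holomorphic_on {z. Im z < 0}"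
      using A G nz by (intro holomorphic_intros) auto
    show "continuous_on {z. Im z \<le> 0} (\<lambda>w. A w / (G w + of_real e))"
      using A G nz by (intro continuous_intros) auto
    show "norm (A w / (G w + of_real e)) \<le> M / e" if "Im w \<le> 0" for w
      using bound[OF that] ge[OF that] e unfolding norm_divide
      by (intro frac_le) (auto intro: order_trans[OF norm_ge_zero])
    show "norm (A (of_real x) / (G (of_real x) + of_real e)) \<le> 1" for x :: real
    proof -
      have "norm (G (of_real x)) \<le> norm (G (of_real x) + of_real e)"
        using pos[of "of_real x"] e by (simp add: cmod_def power_mono)
      then show ?thesis
        using real[of x] nz[of "of_real x"] by (simp add: norm_divide divide_le_eq)
    qed
  qed
  then have "norm (A z) \<le> norm (G z + of_real e)"
    using nz[OF z] by (simp add: norm_divide divide_le_eq)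
  also have "\<dots> \<le> norm (G z) + e"
    using norm_triangle_ineq[of "G z" "of_real e"] e by simp
  finally show "norm (A z) \<le> norm (G z) + e" .
qed

text \<open>
  Near the zero, \<open>G (z + s cis \<theta>)\<close> is approximately \<open>a s^k cis (k \<theta>)\<close> with \<open>a \<noteq> 0\<close> and \<open>k\<close> the
  order. It points in the negative real direction if \<open>Arg a + k \<theta> = - \<pi>\<close>, and this \<open>\<theta>\<close> lies in the
  stated range because \<open>- \<pi> < Arg a \<le> \<pi>\<close>.
\<close>

lemma zero_negative_direction:
  assumes G: "G holomorphic_on UNIV" "G z = 0" "\<exists>w. G w \<noteq> 0"
  obtains \<theta> where "- 2 * pi / of_int (zorder G z) \<le> \<theta>" "\<theta> < 0" "zorder G z > 0"
    "\<forall>\<^sub>F s in at_right 0. Re (G (z + of_real s * cis \<theta>)) < 0"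
proof -
  define k where "k = nat (zorder G z)"
  define g where "g = zor_poly G z"
  obtain r where n: "zorder G z > 0" and r: "r > 0" "g holomorphic_on cball z r"
    and Gg: "\<And>w. w \<in> cball z r \<Longrightarrow> G w = g w * (w - z) ^ k \<and> g w \<noteq> 0"
    using zorder_exist_zero[OF G(1) open_UNIV connected_UNIV UNIV_I, of z] G(2,3)
    unfolding k_def g_def by auto
  define \<theta> where "\<theta> = (- pi - Arg (g z)) / k"
  have k: "k > 0" "real k = of_int (zorder G z)" using n by (auto simp: k_def)
  have dir: "g z * cis \<theta> ^ k = - of_real (norm (g z))"
  proof -
    have "g z * cis \<theta> ^ k = of_real (norm (g z)) * (cis (Arg (g z)) * cis (k * \<theta>))"
      by (subst (1) rcis_cmod_Arg[symmetric]) (simp add: rcis_def Complex.DeMoivre mult.assoc)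
    also have "k * \<theta> = - pi - Arg (g z)" using k by (simp add: \<theta>_def)
    finally show ?thesis by (simp add: cis_mult complex_eq_iff)
  qed
  have lim: "((\<lambda>s. Re (g (z + of_real s * cis \<theta>) * cis \<theta> ^ k)) \<longlongrightarrow> Re (g z * cis \<theta> ^ k)) (at_right 0)"
  proof -
    have "isCont g z"
      using r holomorphic_on_imp_continuous_on[OF r(2)] continuous_on_interior[of "cball z r" g z] by simp
    moreover have "((\<lambda>s. z + of_real s * cis \<theta>) \<longlongrightarrow> z + of_real 0 * cis \<theta>) (at_right 0)"
      by (intro tendsto_intros)
    ultimately show ?thesis
      by (intro tendsto_intros) (auto intro: isCont_tendsto_compose)
  qed
  have "Re (g z * cis \<theta> ^ k) < 0"
    unfolding dir using Gg[of z] r(1) by simp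
  with lim have "\<forall>\<^sub>F s in at_right 0. Re (g (z + of_real s * cis \<theta>) * cis \<theta> ^ k) < 0"
    by (rule order_tendstoD)
  moreover have "\<forall>\<^sub>F s in at_right 0. s \<in> {0<..<r}"
    using r(1) by (rule eventually_at_right_real)
  ultimately have "\<forall>\<^sub>F s in at_right 0. Re (G (z + of_real s * cis \<theta>)) < 0"
  proof eventually_elim
    case (elim s)
    have "G (z + of_real s * cis \<theta>) = of_real (s ^ k) * (g (z + of_real s * cis \<theta>) * cis \<theta> ^ k)"
      using Gg[of "z + of_real s * cis \<theta>"] elim(2)
      by (simp add: dist_norm norm_mult power_mult_distrib)
    also have "Re \<dots> = s ^ k * Re (g (z + of_real s * cis \<theta>) * cis \<theta> ^ k)"
      by (simp only: times_complex.sel Re_complex_of_real Im_complex_of_real mult_zero_left diff_zero)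
    finally show ?case
      using elim by (simp add: mult_pos_neg)
  qed
  moreover have "- 2 * pi / of_int (zorder G z) \<le> \<theta>" "\<theta> < 0"
    unfolding \<theta>_def k(2)[symmetric]
    using Arg_bounded[of "g z"] k(1) by (intro divide_right_mono divide_neg_pos; simp)+
  ultimately show thesis using that n by blast
qed

text \<open>
  The direction of \<open>zero_negative_direction\<close> has to leave the half-plane. From an interior point no
  direction does so at once, and from a boundary point none with \<open>- \<pi> \<le> \<theta> \<le> 0\<close>, which is the
  range that an order of at least 2 would force.
\<close>

lemma zeros_of_Re_nonneg_lower_half_plane:
  assumes G: "G holomorphic_on UNIV" "\<exists>w. G w \<noteq> 0"
    and pos: "\<And>z. Im z \<le> 0 \<Longrightarrow> 0 \<le> Re (G z)"
    and z: "G z = 0" "Im z \<le> 0"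
  shows "Im z = 0 \<and> zorder G z = 1"
proof -
  obtain \<theta> where \<theta>: "- 2 * pi / of_int (zorder G z) \<le> \<theta>" "\<theta> < 0" "zorder G z > 0"
    and neg: "\<forall>\<^sub>F s in at_right 0. Re (G (z + of_real s * cis \<theta>)) < 0"
    using zero_negative_direction[OF G(1) z(1) G(2)] by blast
  have leaves: "\<not> (\<forall>\<^sub>F s in at_right 0. Im (z + of_real s * cis \<theta>) \<le> 0)"
  proof
    assume "\<forall>\<^sub>F s in at_right 0. Im (z + of_real s * cis \<theta>) \<le> 0"
    with neg have "\<forall>\<^sub>F s in at_right (0::real). False"
      by eventually_elim (metis pos not_less)
    then show False by simp
  qed
  have "Im z = 0"
  proof (rule ccontr)
    assume "Im z \<noteq> 0"
    moreover have "((\<lambda>s. Im (z + of_real s * cis \<theta>)) \<longlongrightarrow> Im (z + of_real 0 * cis \<theta>)) (at_right 0)"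
      by (intro tendsto_intros)
    ultimately have "\<forall>\<^sub>F s in at_right 0. Im (z + of_real s * cis \<theta>) < 0"
      using z(2) by (intro order_tendstoD(2)) auto
    then have "\<forall>\<^sub>F s in at_right 0. Im (z + of_real s * cis \<theta>) \<le> 0"
      by eventually_elim simp
    with leaves show False ..
  qed
  moreover have "zorder G z < 2"
  proof (rule ccontr)
    assume "\<not> zorder G z < 2"
    then have "2 * pi / of_int (zorder G z) \<le> 2 * pi / 2"
      by (intro divide_left_mono) auto
    then have "- pi \<le> \<theta>" using \<theta>(1) by simp
    then have "sin \<theta> \<le> 0" using \<theta>(2) sin_ge_zero[of "- \<theta>"] by simp
    have "\<forall>\<^sub>F s in at_right 0. Im (z + of_real s * cis \<theta>) \<le> 0"
      using eventually_at_right_less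
      by eventually_elim (use \<open>Im z = 0\<close> \<open>sin \<theta> \<le> 0\<close> in \<open>simp add: mult_nonneg_nonpos\<close>)
    with leaves show False ..
  qed
  ultimately show ?thesis using \<theta>(3) by simp
qed

section \<open>Fourier-Stieltjes transforms in the Hermite-Biehler class\<close>

theorem theorem1p3:
  fixes \<sigma> :: real and \<mu> :: "real \<Rightarrow> real" and F C :: "complex \<Rightarrow> complex"
  assumes "\<sigma> > 0"
    and "bounded_variation_on \<mu> 0 \<sigma>"
    and "\<And>z. F z = stieltjes_integral 0 \<sigma> (\<lambda>t. exp (\<i> * z * of_real t)) \<mu>"
    and "\<And>z. C z = - stieltjes_integral 0 \<sigma> (\<lambda>t. cos (z * of_real t)) (\<lambda>t. \<mu> (\<sigma> - t))"
    and "\<forall>x::real. C (of_real x) \<in> \<real>\<^sub>\<ge>\<^sub>0"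
    and "\<exists>z. F z \<noteq> 0"
  shows "F \<in> HB_bar \<and> \<not> trivial_HB F \<and>
         (\<forall>x::real. F (of_real x) = 0 \<longrightarrow> zorder F (of_real x) = 1)"
proof -
  obtain V where dom: "\<And>x y. 0 \<le> x \<Longrightarrow> x \<le> y \<Longrightarrow> y \<le> \<sigma> \<Longrightarrow> \<bar>\<mu> y - \<mu> x\<bar> \<le> V y - V x"
    using bounded_variation_on_dominated[OF assms(2)] by blast
  have \<sigma>: "0 \<le> \<sigma>" using assms(1) by simp
  have int: "has_stieltjes_integral (\<lambda>t. exp (\<i> * z * of_real t)) \<mu> 0 \<sigma> (F z)" for z
    unfolding assms(3) by (rule has_stieltjes_integral_exp[of 0 \<sigma> \<mu> V, OF \<sigma> dom])
  have hol: "F holomorphic_on UNIV"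
    using fourier_stieltjes_entire[of 0 \<sigma> \<mu> V, OF \<sigma> dom] by (simp add: assms(3)[abs_def])
  define G where "G = (\<lambda>z. exp (- \<i> * of_real \<sigma> * z) * F z)"
  have holG: "G holomorphic_on UNIV"
    unfolding G_def using hol by (intro holomorphic_intros)
  have cnjF: "cnj (F (cnj z)) = F (- z)" for z
  proof -
    have "has_stieltjes_integral (\<lambda>t. cnj (exp (\<i> * cnj z * of_real t))) \<mu> 0 \<sigma> (cnj (F (cnj z)))"
      by (rule has_stieltjes_integral_bounded_linear[OF bounded_linear_cnj int])
    then have "has_stieltjes_integral (\<lambda>t. exp (\<i> * (- z) * of_real t)) \<mu> 0 \<sigma> (cnj (F (cnj z)))"
      by (simp add: exp_cnj)
    then show ?thesis using int[of "- z"] has_stieltjes_integral_unique by blast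
  qed
  have boundF: "norm (F (- z)) \<le> V \<sigma> - V 0" if "Im z \<le> 0" for z
    using norm_stieltjes_integral_le[of 0 \<sigma> \<mu> V, OF \<sigma> dom int[of "- z"], of 1] that
    by (simp add: mult_nonneg_nonneg mult_nonpos_nonneg)
  have intG: "has_stieltjes_integral (\<lambda>t. exp (\<i> * z * (of_real t - of_real \<sigma>))) \<mu> 0 \<sigma> (G z)" for z
  proof -
    have "has_stieltjes_integral (\<lambda>t. exp (- \<i> * of_real \<sigma> * z) * exp (\<i> * z * of_real t)) \<mu> 0 \<sigma> (G z)"
      unfolding G_def
      by (rule has_stieltjes_integral_bounded_linear[OF bounded_linear_mult_right int])
    then show ?thesis by (simp add: exp_add[symmetric] algebra_simps)
  qed
  have boundG: "norm (G z) \<le> V \<sigma> - V 0" if "Im z \<le> 0" for z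
    using norm_stieltjes_integral_le[of 0 \<sigma> \<mu> V, OF \<sigma> dom intG[of z], of 1] that
    by (simp add: mult_nonpos_nonpos)
  have C: "C z = (G z + G (- z)) / 2" for z
  proof -
    have der: "((\<lambda>t. cos (z * of_real t)) has_vector_derivative - z * sin (z * of_real t)) (at t)" for t
      by (auto intro!: derivative_eq_intros has_vector_derivative_real_field)
    have cont: "continuous_on UNIV (\<lambda>t. - z * sin (z * complex_of_real t))"
      by (intro continuous_intros)
    have "C z = stieltjes_integral 0 \<sigma> (\<lambda>t. cos (z * of_real (\<sigma> - t))) \<mu>"
      using stieltjes_integral_reflect[of \<sigma> \<mu> V, OF \<sigma> dom der cont] by (simp add: assms(4))
    also have "\<dots> = (G z + G (- z)) / 2"
    proof (rule stieltjes_integral_eqI)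
      have "has_stieltjes_integral (\<lambda>t. (exp (\<i> * z * (of_real t - of_real \<sigma>))
          + exp (\<i> * (- z) * (of_real t - of_real \<sigma>))) / 2) \<mu> 0 \<sigma> ((G z + G (- z)) / 2)"
        by (rule has_stieltjes_integral_bounded_linear[OF bounded_linear_divide
              has_stieltjes_integral_add[OF intG intG]])
      then show "has_stieltjes_integral (\<lambda>t. cos (z * of_real (\<sigma> - t))) \<mu> 0 \<sigma> ((G z + G (- z)) / 2)"
        by (simp add: cos_exp_eq algebra_simps)
    qed
    finally show ?thesis .
  qed
  have ReG: "0 \<le> Re (G z)" if "Im z \<le> 0" for z
  proof (rule Re_nonneg_lower_half_plane[OF _ _ boundG _ that])
    fix x :: real
    have "G (- of_real x) = cnj (G (of_real x))"
      using cnjF[of "of_real x"] by (simp add: G_def exp_cnj)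
    then have "Re (G (of_real x)) = Re (C (of_real x))"
      by (simp add: C)
    also have "\<dots> \<ge> 0"
      using assms(5) by (auto simp: complex_nonneg_Reals_iff)
    finally show "0 \<le> Re (G (of_real x))" .
  qed (use holG in \<open>auto intro: holomorphic_on_subset holomorphic_on_imp_continuous_on continuous_on_subset\<close>)
  have normG: "norm (G z) = exp (\<sigma> * Im z) * norm (F z)" for z
    by (simp add: G_def norm_mult)
  have holF': "(\<lambda>z. F (- z)) holomorphic_on UNIV"
    using holomorphic_on_compose[of uminus UNIV F] hol
    by (simp add: o_def holomorphic_on_minus holomorphic_on_subset)
  \<comment> \<open>The bound has \<open>G\<close>, not \<open>F\<close>, on the right, which gains the factor \<open>exp (\<sigma> * Im z)\<close>.\<close>
  have key: "norm (F (- z)) \<le> exp (\<sigma> * Im z) * norm (F z)" if "Im z \<le> 0" for z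
    unfolding normG[symmetric]
  proof (rule norm_le_of_Re_nonneg_lower_half_plane[where A = "\<lambda>z. F (- z)", OF _ _ _ _ boundF ReG _ that])
    show "norm (F (- of_real x)) \<le> norm (G (of_real x))" for x :: real
      using cnjF[of "of_real x"] by (simp add: normG flip: cnjF)
  qed (use holG holF' in \<open>auto intro: holomorphic_on_subset holomorphic_on_imp_continuous_on continuous_on_subset\<close>)
  have nzG: "\<exists>w. G w \<noteq> 0" using assms(6) by (simp add: G_def)
  have zeros: "Im z = 0 \<and> zorder G z = 1" if "F z = 0" "Im z \<le> 0" for z
    using zeros_of_Re_nonneg_lower_half_plane[OF holG nzG ReG] that by (simp add: G_def)
  have nz: "F z \<noteq> 0" if "Im z < 0" for z
    using zeros[of z] that by auto
  have "F \<in> HB_bar"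
    unfolding HB_bar_def
  proof (safe)
    fix z :: complex assume "Im z > 0"
    have "norm (F z) \<le> exp (\<sigma> * Im (- z)) * norm (F (- z))"
      using key[of "- z"] \<open>Im z > 0\<close> by simp
    also have "\<dots> \<le> 1 * norm (F (- z))"
      using \<sigma> \<open>Im z > 0\<close> by (intro mult_right_mono) auto
    finally show "norm (F z / conj_fun F z) \<le> 1"
      using nz[of "- z"] \<open>Im z > 0\<close> by (simp add: conj_fun_def cnjF norm_divide divide_le_eq)
  qed (use hol nz in auto)
  moreover have "\<not> trivial_HB F"
  proof
    assume "trivial_HB F"
    then obtain c g where g: "real_entire g" "\<And>z. F z = c * g z"
      unfolding trivial_HB_def by blast
    have "norm (F (- z)) = norm (F z)" for z
    proof -
      have "cnj (g (cnj z)) = g z"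
        using conj_fun_real_entire[OF g(1)] by (metis conj_fun_def)
      then have "F (- z) = cnj c * g z"
        using cnjF[of z] by (simp add: g(2)[of "cnj z"])
      then show ?thesis
        by (simp add: g(2) norm_mult)
    qed
    then have "norm (F (- \<i>)) \<le> exp (- \<sigma>) * norm (F (- \<i>))"
      using key[of "- \<i>"] by simp
    moreover have "norm (F (- \<i>)) > 0" "exp (- \<sigma>) < 1"
      using nz[of "- \<i>"] assms(1) by auto
    ultimately show False by (simp add: mult_le_cancel_right1)
  qed
  moreover have "zorder F (of_real x) = 1" if "F (of_real x) = 0" for x :: real
  proof -
    have "zorder G (of_real x) = zorder (\<lambda>z. exp (- \<i> * of_real \<sigma> * z)) (complex_of_real x) + zorder F (of_real x)"
      unfolding G_def
    proof (rule zorder_times_analytic)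
      show "F analytic_on {complex_of_real x}"
        using hol by (meson analytic_on_holomorphic open_UNIV subset_UNIV)
      show "\<forall>\<^sub>F z in at (complex_of_real x). exp (- \<i> * of_real \<sigma> * z) * F z \<noteq> 0"
        using non_zero_neighbour_alt[OF hol open_UNIV connected_UNIV UNIV_I UNIV_I] assms(6) by auto
    qed (auto intro!: analytic_intros)
    moreover have "zorder (\<lambda>z. exp (- \<i> * of_real \<sigma> * z)) (complex_of_real x) = 0"
      by (intro zorder_eq_0I) (auto intro!: analytic_intros)
    ultimately show ?thesis using zeros[of "of_real x"] that by simp
  qed
  ultimately show ?thesis by blast
qed

end
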